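(* Let $0<\lambda\le 1$. Let $f(z)=z+a_2z^2+a_3z^3+\cdots$ belong to $\mathcal{U}(\lambda)$ and satisfy the subordination $$\frac{f(z)}{z}\prec\frac{1}{(1+z)(1+\lambda z)}\qquad (z\in\mathbb{D}),$$ and let $f^{-1}(w)=w+A_2w^2+A_3w^3+A_4w^4+\cdots$ be the expansion of the inverse of $f$ near the origin. Then $$|A_2|\le 1+\lambda,\qquad |A_3|\le 1+3\lambda+\lambda^2,\qquad |A_4|\le (1+\lambda)(1+5\lambda+\lambda^2).$$ All three inequalities are best possible: for every $\lambda\in(0,1]$ and for each of the three inequalities, there is a function $f\in\mathcal{U}(\lambda)$ satisfying $\frac{f(z)}{z}\prec\frac{1}{(1+z)(1+\lambda z)}$ $(z\in\mathbb{D})$ for which equality holds.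
   Context: $\mathbb{D}=\{z\in\mathbb{C}:|z|<1\}$ is the open unit disk. $\mathcal{A}$ is the family of all analytic functions $f$ in $\mathbb{D}$ with $f(0)=0$ and $f'(0)=1$. For $0<\lambda\le1$, $\mathcal{U}(\lambda)$ is the set of all $f\in\mathcal{A}$ satisfying $$\left|\left(\frac{z}{f(z)}\right)^2f'(z)-1\right|<\lambda\qquad(z\in\mathbb{D}),$$ where $f(z)\ne0$ for $z\in\mathbb{D}\setminus\{0\}$ is understood, and $z/f(z)$ and $f(z)/z$ are both given the value $1$ at $z=0$. Subordination: for $F,G$ analytic in $\mathbb{D}$, $F\prec G$ means that there is a function $\omega$ analytic in $\mathbb{D}$ with $\omega(0)=0$, $|\omega(z)|<1$ for all $z\in\mathbb{D}$, and $F(z)=G(\omega(z))$ for all $z\in\mathbb{D}$. Since $f(0)=0$ and $f'(0)=1$, $f$ has a local analytic inverse $f^{-1}$ near $0$ with $f^{-1}(0)=0$; the $A_n$ are its Taylor coefficients at $0$. *)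

theory Defs
  imports "HOL-Complex_Analysis.Complex_Analysis"
begin

abbreviation unit_disk :: "complex set" where
  "unit_disk \<equiv> ball 0 1"

definition class_A :: "(complex \<Rightarrow> complex) set" where
  "class_A = {f. f holomorphic_on unit_disk \<and> f 0 = 0 \<and> deriv f 0 = 1}"

text \<open>The quotients \<open>f(z)/z\<close> and \<open>z/f(z)\<close> with their removable singularity at \<open>0\<close>
  filled in by the value 1, which is the limit for \<open>f\<close> in \<^const>\<open>class_A\<close>.\<close>

definition quot_fz :: "(complex \<Rightarrow> complex) \<Rightarrow> complex \<Rightarrow> complex" where
  "quot_fz f z = (if z = 0 then 1 else f z / z)"

definition quot_zf :: "(complex \<Rightarrow> complex) \<Rightarrow> complex \<Rightarrow> complex" where
  "quot_zf f z = (if z = 0 then 1 else z / f z)"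

definition class_U :: "real \<Rightarrow> (complex \<Rightarrow> complex) set" where
  "class_U lam = {f \<in> class_A.
     (\<forall>z\<in>unit_disk - {0}. f z \<noteq> 0) \<and>
     (\<forall>z\<in>unit_disk. cmod ((quot_zf f z)\<^sup>2 * deriv f z - 1) < lam)}"

definition subordinate :: "(complex \<Rightarrow> complex) \<Rightarrow> (complex \<Rightarrow> complex) \<Rightarrow> bool"
    (infix "\<prec>\<^sub>D" 50) where
  "F \<prec>\<^sub>D G \<longleftrightarrow> F holomorphic_on unit_disk \<and> G holomorphic_on unit_disk \<and>
     (\<exists>\<omega>. \<omega> holomorphic_on unit_disk \<and> \<omega> 0 = 0 \<and>
          (\<forall>z\<in>unit_disk. cmod (\<omega> z) < 1) \<and>
          (\<forall>z\<in>unit_disk. F z = G (\<omega> z)))"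

text \<open>\<open>g\<close> is an analytic local inverse of \<open>f\<close> at the origin; only the germ of \<open>g\<close> at \<open>0\<close>
  is constrained, and the germ is determined by \<open>f\<close>.\<close>

definition is_local_inverse :: "(complex \<Rightarrow> complex) \<Rightarrow> (complex \<Rightarrow> complex) \<Rightarrow> bool" where
  "is_local_inverse f g \<longleftrightarrow> g analytic_on {0} \<and> g 0 = 0 \<and>
     (\<forall>\<^sub>F w in nhds 0. f (g w) = w) \<and> (\<forall>\<^sub>F z in nhds 0. g (f z) = z)"

lemma local_inverse_exists:
  assumes "f \<in> class_A"
  shows "\<exists>g. is_local_inverse f g"
proof -
  have hol: "f holomorphic_on unit_disk" and f0: "f 0 = 0" and d: "deriv f 0 = 1"
    using assms by (auto simp: class_A_def)
  obtain r where r: "r > 0" "ball 0 r \<subseteq> unit_disk" "inj_on f (ball 0 r)"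
    using has_complex_derivative_locally_injective[OF hol, of 0] d by auto
  have holr: "f holomorphic_on ball 0 r"
    using hol r(2) holomorphic_on_subset by blast
  obtain g where g: "g holomorphic_on f ` ball 0 r"
      "\<And>z. z \<in> ball 0 r \<Longrightarrow> deriv f z * deriv g (f z) = 1"
      "\<And>z. z \<in> ball 0 r \<Longrightarrow> g (f z) = z"
    using holomorphic_has_inverse[OF holr open_ball r(3)] by blast
  have op: "open (f ` ball 0 r)"
    using open_mapping_thm3[OF holr open_ball r(3)] .
  have in0: "0 \<in> f ` ball 0 r"
    using f0 r(1) by (metis centre_in_ball imageI)
  have "g analytic_on {0}"
    using g(1) op in0 by (meson analytic_at)
  moreover have "g 0 = 0"
    using g(3)[of 0] f0 r(1) by simp
  moreover have "\<forall>\<^sub>F w in nhds 0. f (g w) = w"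
    using eventually_nhds_in_open[OF op in0] by eventually_elim (auto simp: g(3))
  moreover have "\<forall>\<^sub>F z in nhds 0. g (f z) = z"
    using eventually_nhds_in_open[of "ball 0 r" 0] r(1) by (auto elim!: eventually_mono simp: g(3))
  ultimately show ?thesis
    unfolding is_local_inverse_def by blast
qed

lemma local_inverse_unique:
  assumes "is_local_inverse f g" "is_local_inverse f h"
  shows "\<forall>\<^sub>F w in nhds 0. g w = h w"
proof -
  have "isCont g 0"
    using assms(1) by (simp add: is_local_inverse_def analytic_at_imp_isCont)
  hence "filterlim g (nhds 0) (nhds 0)"
    using assms(1) by (simp add: is_local_inverse_def isCont_def tendsto_at_iff_tendsto_nhds)
  hence "\<forall>\<^sub>F w in nhds 0. h (f (g w)) = g w"
    using assms(2) unfolding is_local_inverse_def filterlim_iff by blast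
  moreover have "\<forall>\<^sub>F w in nhds 0. f (g w) = w"
    using assms(1) by (simp add: is_local_inverse_def)
  ultimately show ?thesis
    by eventually_elim simp
qed

abbreviation taylor_coeff :: "(complex \<Rightarrow> complex) \<Rightarrow> nat \<Rightarrow> complex" where
  "taylor_coeff g n \<equiv> fps_nth (fps_expansion g 0) n"

end

theory Submission
  imports Defs
begin

text \<open>Put \<open>q = z / f = 1 + q\<^sub>1 z + q\<^sub>2 z\<^sup>2 + q\<^sub>3 z\<^sup>3 + \<dots>\<close>. Inverting \<open>w = z / q(z)\<close> gives
  \<open>A\<^sub>2 = q\<^sub>1\<close>, \<open>A\<^sub>3 = q\<^sub>2 + q\<^sub>1\<^sup>2\<close> and \<open>A\<^sub>4 = q\<^sub>3 + 3 q\<^sub>1 q\<^sub>2 + q\<^sub>1\<^sup>3\<close>.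
  The subordination reads \<open>q = (1 + \<omega>) (1 + \<lambda> \<omega>)\<close>, so \<open>\<bar>q\<^sub>1\<bar> \<le> 1 + \<lambda>\<close> by the Schwarz lemma.
  Since \<open>(z / f)\<^sup>2 f' - 1 = q - z q' - 1 = - q\<^sub>2 z\<^sup>2 - 2 q\<^sub>3 z\<^sup>3 - \<dots>\<close> is bounded by \<open>\<lambda>\<close>, it is \<open>z\<^sup>2\<close> times
  a function bounded by \<open>\<lambda>\<close>, and Schwarz--Pick at the origin yields
  \<open>2 \<lambda> \<bar>q\<^sub>3\<bar> + \<bar>q\<^sub>2\<bar>\<^sup>2 \<le> \<lambda>\<^sup>2\<close>; in particular \<open>\<bar>q\<^sub>3\<bar> \<le> \<lambda> - \<bar>q\<^sub>2\<bar>\<close>, so the bound for \<open>A\<^sub>4\<close> is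
  largest at \<open>\<bar>q\<^sub>2\<bar> = \<lambda>\<close>. All bounds are attained by \<open>q = (1 + z) (1 + \<lambda> z)\<close>.\<close>

section \<open>Schwarz and Schwarz--Pick estimates at the origin\<close>

text \<open>Dividing out the zero at the origin preserves the bound. The classical Schwarz lemma
  asks for strict inequality, so it is applied to \<open>f / k\<close> with
  \<open>k = M + e\<close>, and \<open>e\<close> is arbitrary; this also covers
  \<open>M = 0\<close>.\<close>

lemma Schwarz_factor:
  fixes f :: "complex \<Rightarrow> complex"
  assumes hol: "f holomorphic_on ball 0 1" and f0: "f 0 = 0"
    and le: "\<And>z. cmod z < 1 \<Longrightarrow> cmod (f z) \<le> M"
  obtains h where "h holomorphic_on ball 0 1" "\<And>z. cmod z < 1 \<Longrightarrow> f z = z * h z"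
    "\<And>z. cmod z < 1 \<Longrightarrow> cmod (h z) \<le> M"
proof -
  obtain h where h: "h holomorphic_on ball 0 1" "\<And>z. cmod z < 1 \<Longrightarrow> f z = z * h z"
      "deriv f 0 = h 0"
    using Schwarz3[OF hol f0] by metis
  have M: "0 \<le> M" using le[of 0] f0 by simp
  have "cmod (h z) \<le> M" if z: "cmod z < 1" for z
  proof (rule field_le_epsilon)
    fix e :: real assume e: "e > 0"
    define k where "k = M + e"
    have k: "k > 0" "M < k" using M e by (auto simp: k_def)
    have kh: "(\<lambda>z. f z / of_real k) holomorphic_on ball 0 1"
      using k by (intro holomorphic_intros hol) auto
    have lt: "cmod (f z / of_real k) < 1" if "cmod z < 1" for z
      using le[OF that] k by (simp add: norm_divide)
    have k0: "f 0 / of_real k = 0" by (simp add: f0)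
    have S: "cmod (f z / of_real k) \<le> cmod z" "cmod (deriv (\<lambda>z. f z / of_real k) 0) \<le> 1"
      using Schwarz_Lemma(1)[OF kh k0 lt z] Schwarz_Lemma(2)[OF kh k0 lt z] by auto
    show "cmod (h z) \<le> M + e"
    \<comment> \<open>At the origin \<open>h 0\<close> is \<open>deriv f 0\<close>, so the
      derivative half of the Schwarz lemma is used; elsewhere the growth half is divided by
      \<open>z\<close>.\<close>
    proof (cases "z = 0")
      case True
      have "deriv (\<lambda>z. f z / of_real k) 0 = deriv f 0 / of_real k"
        using hol by (intro deriv_cdivide_right) (auto simp: holomorphic_on_imp_differentiable_at)
      then have "cmod (h 0) / k \<le> 1" using S(2) k h(3) by (simp add: norm_divide)
      then show ?thesis using k True by (simp add: k_def)
    next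
      case False
      have "cmod z * cmod (h z) \<le> cmod z * k"
        using S(1) k h(2)[OF z] by (simp add: norm_divide norm_mult pos_divide_le_eq)
      then show ?thesis using False by (simp add: k_def)
    qed
  qed
  then show ?thesis using that h by blast
qed

text \<open>A disk automorphism moving \<open>f 0\<close> to \<open>0\<close> reduces this to the
  Schwarz lemma: the composite has derivative of modulus
  \<open>cmod (deriv f 0) / (1 - (cmod (f 0))\<^sup>2)\<close> at \<open>0\<close>.\<close>

lemma Schwarz_Pick_origin_strict:
  assumes hol: "f holomorphic_on ball 0 1" and lt: "\<And>z. cmod z < 1 \<Longrightarrow> cmod (f z) < 1"
  shows "cmod (deriv f 0) + (cmod (f 0))\<^sup>2 \<le> 1"
proof -
  define a where "a = f 0"
  have a: "cmod a < 1" using lt[of 0] by (simp add: a_def)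
  have b: "1 - cnj a * a = of_real (1 - (cmod a)\<^sup>2)"
    by (simp only: complex_norm_square of_real_diff of_real_1 mult.commute)
  have pos: "1 - (cmod a)\<^sup>2 > 0" using a by (simp add: abs_square_less_1)
  define h where "h = Moebius_function 0 a \<circ> f"
  have hh: "h holomorphic_on ball 0 1" unfolding h_def
    by (rule holomorphic_on_compose_gen[OF hol Moebius_function_holomorphic[OF a]]) (auto simp: lt)
  have h0: "h 0 = 0" by (simp add: h_def a_def Moebius_function_eq_zero)
  have hlt: "cmod (h z) < 1" if "cmod z < 1" for z
    using Moebius_function_norm_lt_1[OF a lt[OF that]] by (simp add: h_def)
  have "cmod (deriv h 0) \<le> 1"
    using Schwarz_Lemma(2)[OF hh h0 hlt, of 0] by simp
  moreover have "deriv h 0 = deriv f 0 / (1 - cnj a * a)"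
  proof (rule DERIV_imp_deriv)
    have d: "(f has_field_derivative deriv f 0) (at 0)"
      using hol by (intro holomorphic_derivI[of _ "ball 0 1"]) auto
    have nz: "1 - cnj a * f 0 \<noteq> 0" using b pos unfolding a_def by (metis less_irrefl of_real_eq_0_iff)
    have "h = (\<lambda>z. (f z - a) / (1 - cnj a * f z))"
      by (auto simp: h_def Moebius_function_simple)
    then show "(h has_field_derivative deriv f 0 / (1 - cnj a * a)) (at 0)"
      using nz by (auto intro!: derivative_eq_intros d simp: a_def)
  qed
  ultimately have "cmod (deriv f 0) / (1 - (cmod a)\<^sup>2) \<le> 1"
    unfolding b using pos by (simp only: norm_divide norm_of_real abs_of_pos)
  then show ?thesis using pos by (simp add: a_def)
qed

text \<open>Scaling by any \<open>k > M\<close> restores strictness. In homogeneous form the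
  inequality passes to the limit as \<open>k\<close> decreases to \<open>M\<close>, including
  \<open>M = 0\<close>.\<close>

lemma Schwarz_Pick_origin:
  assumes hol: "f holomorphic_on ball 0 1" and le: "\<And>z. cmod z < 1 \<Longrightarrow> cmod (f z) \<le> M"
  shows "M * cmod (deriv f 0) + (cmod (f 0))\<^sup>2 \<le> M\<^sup>2"
proof -
  have M: "0 \<le> M" using order_trans[OF norm_ge_zero le[of 0]] by simp
  have *: "k * cmod (deriv f 0) + (cmod (f 0))\<^sup>2 \<le> k\<^sup>2" if k: "k > M" for k
  proof -
    have kp: "k > 0" using k M by simp
    have "cmod (deriv (\<lambda>z. f z / of_real k) 0) + (cmod (f 0 / of_real k))\<^sup>2 \<le> 1"
    proof (rule Schwarz_Pick_origin_strict)
      show "(\<lambda>z. f z / of_real k) holomorphic_on ball 0 1"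
        using kp by (intro holomorphic_intros hol) auto
      show "cmod (f z / of_real k) < 1" if "cmod z < 1" for z
        using le[OF that] k kp by (simp add: norm_divide)
    qed
    moreover have "deriv (\<lambda>z. f z / of_real k) 0 = deriv f 0 / of_real k"
      using hol by (intro deriv_cdivide_right) (auto simp: holomorphic_on_imp_differentiable_at)
    ultimately show ?thesis
      using kp by (simp add: norm_divide power_divide field_simps power2_eq_square)
  qed
  have "((\<lambda>k. k\<^sup>2 - (k * cmod (deriv f 0) + (cmod (f 0))\<^sup>2)) \<longlongrightarrow>
      M\<^sup>2 - (M * cmod (deriv f 0) + (cmod (f 0))\<^sup>2)) (at_right M)"
    by (intro tendsto_intros)
  moreover have "\<forall>\<^sub>F k in at_right M. 0 \<le> k\<^sup>2 - (k * cmod (deriv f 0) + (cmod (f 0))\<^sup>2)"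
    using * by (auto simp: eventually_at_right_less eventually_at_filter)
  ultimately have "0 \<le> M\<^sup>2 - (M * cmod (deriv f 0) + (cmod (f 0))\<^sup>2)"
    by (rule tendsto_lowerbound) simp
  then show ?thesis by simp
qed

section \<open>Coefficients of the inverse function\<close>

text \<open>The hypothesis is \<open>w = z / Q(z)\<close> solved for the inverse series \<open>z = A(w)\<close>.\<close>

lemma inverse_coeffs:
  fixes A Q :: "'a::comm_ring_1 fps"
  assumes A: "A = fps_X * fps_compose Q A" and Q0: "fps_nth Q 0 = 1"
  shows "fps_nth A 2 = fps_nth Q 1"
    and "fps_nth A 3 = fps_nth Q 2 + (fps_nth Q 1)\<^sup>2"
    and "fps_nth A 4 = fps_nth Q 3 + 3 * fps_nth Q 1 * fps_nth Q 2 + (fps_nth Q 1) ^ 3"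
proof -
  \<comment> \<open>Because of the factor \<open>fps_X\<close>, the right side involves only
    coefficients of \<open>A\<close> up to index \<open>n\<close>, so this is a recursion.\<close>
  have step: "fps_nth A (Suc n) = (\<Sum>i=0..n. fps_nth Q i * fps_nth (A ^ i) n)" for n
    by (subst A) (simp add: fps_compose_nth)
  have A0: "fps_nth A 0 = 0" by (subst A) simp
  have A1: "fps_nth A (Suc 0) = 1" by (subst step) (simp add: Q0)
  have A2: "fps_nth A (Suc (Suc 0)) = fps_nth Q (Suc 0)"
    by (subst step) (simp add: Q0 A0 A1)
  have A3: "fps_nth A (Suc (Suc (Suc 0))) = fps_nth Q (Suc (Suc 0)) + (fps_nth Q (Suc 0))\<^sup>2"
    by (subst step) (simp add: Q0 A0 A1 A2 fps_mult_nth power2_eq_square algebra_simps)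
  have A4: "fps_nth A (Suc (Suc (Suc (Suc 0)))) = fps_nth Q (Suc (Suc (Suc 0)))
      + 3 * fps_nth Q (Suc 0) * fps_nth Q (Suc (Suc 0)) + (fps_nth Q (Suc 0)) ^ 3"
    by (subst step) (simp add: Q0 A0 A1 A2 A3 fps_mult_nth power2_eq_square power3_eq_cube algebra_simps)
  show "fps_nth A 2 = fps_nth Q 1"
    and "fps_nth A 3 = fps_nth Q 2 + (fps_nth Q 1)\<^sup>2"
    and "fps_nth A 4 = fps_nth Q 3 + 3 * fps_nth Q 1 * fps_nth Q 2 + (fps_nth Q 1) ^ 3"
    using A2 A3 A4 by (simp_all add: numeral_2_eq_2 numeral_3_eq_3 eval_nat_numeral)
qed

text \<open>With \<open>f = z / q\<close>, the identity \<open>f (g w) = w\<close> becomes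
  \<open>g w = w * q (g w)\<close> near \<open>0\<close>; uniqueness of expansions turns it into the
  formal fixed-point equation.\<close>

lemma local_inverse_coeffs:
  assumes g: "is_local_inverse f g" and Q: "q has_fps_expansion Q" and Q0: "fps_nth Q 0 = 1"
    and fq: "\<And>z. z \<in> unit_disk \<Longrightarrow> f z = z / q z" and nz: "\<And>z. z \<in> unit_disk \<Longrightarrow> q z \<noteq> 0"
  shows "taylor_coeff g 2 = fps_nth Q 1"
    and "taylor_coeff g 3 = fps_nth Q 2 + (fps_nth Q 1)\<^sup>2"
    and "taylor_coeff g 4 = fps_nth Q 3 + 3 * fps_nth Q 1 * fps_nth Q 2 + (fps_nth Q 1) ^ 3"
proof -
  define A where "A = fps_expansion g 0"
  have A: "g has_fps_expansion A"
    using g unfolding A_def is_local_inverse_def by (intro analytic_at_imp_has_fps_expansion_0) auto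
  have A0: "fps_nth A 0 = 0"
    using g has_fps_expansion_imp_0_eq_fps_nth_0[OF A] by (simp add: is_local_inverse_def)
  \<comment> \<open>Continuity keeps \<open>g w\<close> inside the disk for small \<open>w\<close>,
    where \<open>f\<close> may be replaced by \<open>z / q\<close>.\<close>
  have "isCont g 0"
    using g by (simp add: is_local_inverse_def analytic_at_imp_isCont)
  hence "filterlim g (nhds 0) (nhds 0)"
    using g by (simp add: is_local_inverse_def isCont_def tendsto_at_iff_tendsto_nhds)
  moreover have "\<forall>\<^sub>F z in nhds 0. z \<in> unit_disk" by (intro eventually_nhds_in_open) auto
  ultimately have "\<forall>\<^sub>F w in nhds 0. g w \<in> unit_disk" unfolding filterlim_iff by blast
  moreover have "\<forall>\<^sub>F w in nhds 0. f (g w) = w" using g by (simp add: is_local_inverse_def)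
  ultimately have "\<forall>\<^sub>F w in nhds 0. w * (q \<circ> g) w = g w"
    by eventually_elim (metis comp_apply fq nz nonzero_divide_eq_eq)
  moreover have "(\<lambda>w. w * (q \<circ> g) w) has_fps_expansion fps_X * fps_compose Q A"
    by (intro fps_expansion_intros Q A A0)
  ultimately have "g has_fps_expansion fps_X * fps_compose Q A"
    by (subst (asm) has_fps_expansion_cong) auto
  then have "A = fps_X * fps_compose Q A"
    using A fps_expansion_unique_complex by blast
  from inverse_coeffs[OF this Q0]
  show "taylor_coeff g 2 = fps_nth Q 1"
    and "taylor_coeff g 3 = fps_nth Q 2 + (fps_nth Q 1)\<^sup>2"
    and "taylor_coeff g 4 = fps_nth Q 3 + 3 * fps_nth Q 1 * fps_nth Q 2 + (fps_nth Q 1) ^ 3"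
    by (simp_all add: A_def)
qed

section \<open>The class U condition in terms of \<open>z / f\<close>\<close>

text \<open>The quotient rule gives \<open>deriv f z\<close> the denominator
  \<open>(q z)\<^sup>2\<close>, which the factor \<open>(z / f z)\<^sup>2\<close> cancels.\<close>

lemma class_U_functional:
  assumes hol: "q holomorphic_on unit_disk" and z: "z \<in> unit_disk"
    and fq: "\<And>z. z \<in> unit_disk \<Longrightarrow> f z = z / q z" and nz: "\<And>z. z \<in> unit_disk \<Longrightarrow> q z \<noteq> 0"
    and q0: "q 0 = 1"
  shows "(quot_zf f z)\<^sup>2 * deriv f z = q z - z * deriv q z"
proof -
  have "quot_zf f z = q z"
    using fq[OF z] nz[OF z] q0 by (auto simp: quot_zf_def)
  moreover have "deriv f z = deriv (\<lambda>z. z / q z) z"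
    using z fq by (intro deriv_cong_ev eventually_mono[OF eventually_nhds_in_open[of unit_disk z]]) auto
  moreover have "deriv (\<lambda>z. z / q z) z = (q z - z * deriv q z) / (q z)\<^sup>2"
    using z nz hol by (subst deriv_divide)
      (auto simp: holomorphic_on_imp_differentiable_at power2_eq_square)
  ultimately show ?thesis using nz[OF z] by simp
qed

text \<open>For \<open>n \<ge> 1\<close> the coefficient of \<open>z ^ n\<close> in
  \<open>q - z q' - 1\<close> is \<open>(1 - n)\<close> times that of \<open>q\<close>. Hence this
  function is \<open>z\<^sup>2 * p z\<close> with \<open>p\<close> bounded by \<open>M\<close>,
  \<open>p 0 = - q\<^sub>2\<close> and \<open>deriv p 0 = - 2 q\<^sub>3\<close>.\<close>

lemma class_U_coeff_bounds:
  assumes q: "q holomorphic_on unit_disk" "q 0 = 1" and Q: "q has_fps_expansion Q"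
    and U: "\<And>z. z \<in> unit_disk \<Longrightarrow> cmod (q z - z * deriv q z - 1) < M"
  shows "cmod (fps_nth Q 2) \<le> M"
    and "2 * M * cmod (fps_nth Q 3) + (cmod (fps_nth Q 2))\<^sup>2 \<le> M\<^sup>2"
proof -
  define F where "F z = q z - z * deriv q z - 1" for z
  have F: "F has_fps_expansion Q - fps_X * fps_deriv Q - 1"
    unfolding F_def by (intro fps_expansion_intros Q)
  have hF: "F holomorphic_on ball 0 1" unfolding F_def by (intro holomorphic_intros q) auto
  have F0: "F 0 = 0" by (simp add: F_def q)
  have leF: "cmod (F z) \<le> M" if "cmod z < 1" for z
    using U[of z] that by (simp add: F_def)
  obtain h where h: "h holomorphic_on ball 0 1" "\<And>z. cmod z < 1 \<Longrightarrow> F z = z * h z"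
      "\<And>z. cmod z < 1 \<Longrightarrow> cmod (h z) \<le> M"
    using Schwarz_factor[OF hF F0 leF] by metis
  have ev: "\<forall>\<^sub>F z in nhds (0::complex). z \<in> ball 0 1" by (intro eventually_nhds_in_open) auto
  have h_exp: "h has_fps_expansion fps_expansion h 0"
    using h(1) by (intro has_fps_expansion_fps_expansion[of "ball 0 1"]) auto
  have "(\<lambda>z. z * h z) has_fps_expansion fps_X * fps_expansion h 0"
    by (intro fps_expansion_intros h_exp)
  moreover have "\<forall>\<^sub>F z in nhds 0. z * h z = F z" using ev by eventually_elim (simp add: h(2))
  ultimately have "F has_fps_expansion fps_X * fps_expansion h 0"
    by (subst (asm) has_fps_expansion_cong) auto
  then have eq: "Q - fps_X * fps_deriv Q - 1 = fps_X * fps_expansion h 0"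
    using F fps_expansion_unique_complex by blast
  \<comment> \<open>The linear terms of \<open>q\<close> and \<open>z q'\<close> cancel, so a second
    factor \<open>z\<close> can be split off.\<close>
  from arg_cong[OF eq, of "\<lambda>F. fps_nth F 1"] have "h 0 = 0"
    using has_fps_expansion_imp_0_eq_fps_nth_0[OF h_exp] by simp
  then obtain p where p: "p holomorphic_on ball 0 1" "\<And>z. cmod z < 1 \<Longrightarrow> h z = z * p z"
      "\<And>z. cmod z < 1 \<Longrightarrow> cmod (p z) \<le> M"
    using Schwarz_factor[OF h(1) _ h(3)] by metis
  define P where "P = fps_expansion p 0"
  have p_exp: "p has_fps_expansion P"
    unfolding P_def using p(1) by (intro has_fps_expansion_fps_expansion[of "ball 0 1"]) auto
  have "(\<lambda>z. z * (z * p z)) has_fps_expansion fps_X * (fps_X * P)"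
    by (intro fps_expansion_intros p_exp)
  moreover have "\<forall>\<^sub>F z in nhds 0. z * (z * p z) = F z"
    using ev by eventually_elim (simp add: h(2) p(2))
  ultimately have "F has_fps_expansion fps_X * (fps_X * P)"
    by (subst (asm) has_fps_expansion_cong) auto
  then have eq: "Q - fps_X * fps_deriv Q - 1 = fps_X * (fps_X * P)"
    using F fps_expansion_unique_complex by blast
  have P0: "fps_nth P 0 = p 0"
    using has_fps_expansion_imp_0_eq_fps_nth_0[OF p_exp] by simp
  have P1: "fps_nth P 1 = deriv p 0"
    using fps_nth_fps_expansion[OF p_exp, of 1] by simp
  have Q2: "fps_nth Q 2 = - p 0"
    using arg_cong[OF eq, of "\<lambda>F. fps_nth F 2"] P0
    by (simp add: numeral_2_eq_2 algebra_simps) (metis minus_minus)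
  have Q3: "2 * fps_nth Q 3 = - deriv p 0"
    using arg_cong[OF eq, of "\<lambda>F. fps_nth F 3"] P1
    by (simp add: numeral_3_eq_3 algebra_simps) (metis minus_minus)
  show "cmod (fps_nth Q 2) \<le> M" using p(3)[of 0] Q2 by simp
  have "2 * cmod (fps_nth Q 3) = cmod (deriv p 0)"
    using arg_cong[OF Q3, of cmod] by (simp add: norm_mult)
  then show "2 * M * cmod (fps_nth Q 3) + (cmod (fps_nth Q 2))\<^sup>2 \<le> M\<^sup>2"
    using Schwarz_Pick_origin[OF p(1) p(3)] Q2 by (simp add: mult.assoc mult.left_commute)
qed

section \<open>Upper bounds for the inverse coefficients\<close>

lemma U_subordinate_bounds:
  fixes lam :: real
  assumes lam: "0 < lam"
    and f: "f \<in> class_U lam" and g: "is_local_inverse f g"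
    and sub: "quot_fz f \<prec>\<^sub>D (\<lambda>z. 1 / ((1 + z) * (1 + complex_of_real lam * z)))"
  shows "cmod (taylor_coeff g 2) \<le> 1 + lam"
    and "cmod (taylor_coeff g 3) \<le> 1 + 3 * lam + lam\<^sup>2"
    and "cmod (taylor_coeff g 4) \<le> (1 + lam) * (1 + 5 * lam + lam\<^sup>2)"
proof -
  obtain w where w: "w holomorphic_on unit_disk" "w 0 = 0" "\<And>z. z \<in> unit_disk \<Longrightarrow> cmod (w z) < 1"
     "\<And>z. z \<in> unit_disk \<Longrightarrow> quot_fz f z = 1 / ((1 + w z) * (1 + complex_of_real lam * w z))"
    using sub unfolding subordinate_def by blast
  define q where "q z = (1 + w z) * (1 + complex_of_real lam * w z)" for z
  have hq: "q holomorphic_on unit_disk" unfolding q_def by (intro holomorphic_intros w)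
  have q0: "q 0 = 1" by (simp add: q_def w)
  have f0: "f 0 = 0" and fnz: "\<And>z. z \<in> unit_disk - {0} \<Longrightarrow> f z \<noteq> 0"
    and fU: "\<And>z. z \<in> unit_disk \<Longrightarrow> cmod ((quot_zf f z)\<^sup>2 * deriv f z - 1) < lam"
    using f by (auto simp: class_U_def class_A_def)
  have qf: "quot_fz f z = 1 / q z" if "z \<in> unit_disk" for z using w(4)[OF that] by (simp add: q_def)
  have fq: "f z = z / q z" if "z \<in> unit_disk" for z
    using qf[OF that] f0 by (cases "z = 0") (auto simp: quot_fz_def field_simps)
  \<comment> \<open>As division by zero yields \<open>0\<close>, a zero of \<open>q\<close> away
    from the origin would be a zero of \<open>f\<close>, which class U excludes.\<close>
  have nz: "q z \<noteq> 0" if "z \<in> unit_disk" for z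
    using fq[OF that] fnz[of z] that q0 by (cases "z = 0") auto
  define Q where "Q = fps_expansion q 0"
  have Q: "q has_fps_expansion Q"
    unfolding Q_def using hq by (intro has_fps_expansion_fps_expansion[of "ball 0 1"]) auto
  have Q0: "fps_nth Q 0 = 1" using has_fps_expansion_imp_0_eq_fps_nth_0[OF Q] q0 by simp
  have U: "cmod (q z - z * deriv q z - 1) < lam" if "z \<in> unit_disk" for z
    using fU[OF that] class_U_functional[OF hq that fq nz q0] by simp
  note B = class_U_coeff_bounds[OF hq q0 Q U]
  have w_diff: "w field_differentiable at 0"
    using w(1) by (auto simp: holomorphic_on_imp_differentiable_at)
  \<comment> \<open>Since \<open>w 0 = 0\<close>, the quadratic term in \<open>w\<close> contributes
    nothing to the derivative.\<close>
  have "(q has_field_derivative (1 + complex_of_real lam) * deriv w 0) (at 0)"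
    unfolding q_def
    by (auto intro!: derivative_eq_intros field_differentiable_derivI[OF w_diff] simp: w(2) algebra_simps)
  then have "deriv q 0 = (1 + complex_of_real lam) * deriv w 0" by (rule DERIV_imp_deriv)
  moreover have "fps_nth Q 1 = deriv q 0" using fps_nth_fps_expansion[OF Q, of 1] by simp
  moreover have "cmod (deriv w 0) \<le> 1"
    using Schwarz_Lemma(2)[OF w(1,2), of 0] w(3) by simp
  moreover have "cmod (1 + complex_of_real lam) = 1 + lam"
    using lam by (metis abs_of_pos add_pos_pos norm_of_real of_real_1 of_real_add zero_less_one)
  ultimately have Q1: "cmod (fps_nth Q 1) \<le> 1 + lam"
    using lam by (simp add: norm_mult mult_left_le)
  have A: "taylor_coeff g 2 = fps_nth Q 1"
    "taylor_coeff g 3 = fps_nth Q 2 + (fps_nth Q 1)\<^sup>2"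
    "taylor_coeff g 4 = fps_nth Q 3 + 3 * fps_nth Q 1 * fps_nth Q 2 + (fps_nth Q 1) ^ 3"
    by (rule local_inverse_coeffs[OF g Q Q0], erule fq, erule nz)+
  define x y t where "x = cmod (fps_nth Q 2)" and "y = cmod (fps_nth Q 3)" and "t = cmod (fps_nth Q 1)"
  have xyt: "0 \<le> x" "x \<le> lam" "0 \<le> y" "0 \<le> t" "t \<le> 1 + lam" "2 * lam * y + x\<^sup>2 \<le> lam\<^sup>2"
    using B Q1 by (auto simp: x_def y_def t_def)
  have t2: "t\<^sup>2 \<le> (1 + lam)\<^sup>2" and t3: "t ^ 3 \<le> (1 + lam) ^ 3"
    using xyt by (auto intro!: power_mono)
  \<comment> \<open>This is \<open>2 * lam * y \<le> lam\<^sup>2 - x\<^sup>2 = 2 * lam * (lam - x) -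
    (lam - x)\<^sup>2\<close> with the last square dropped.\<close>
  have "lam * y \<le> lam * (lam - x)"
    using xyt(6) sum_squares_bound[of lam x] zero_le_power2[of "lam - x"]
    by (simp add: power2_eq_square algebra_simps)
  then have y: "y \<le> lam - x" using lam by simp
  have tx: "t * x \<le> (1 + lam) * x" using xyt by (intro mult_right_mono)
  \<comment> \<open>The expression \<open>lam - x + 3 * (1 + lam) * x\<close> increases with
    \<open>x\<close>, having slope \<open>3 * (1 + lam) - 1 > 0\<close>, so its maximum is at
    \<open>x = lam\<close>.\<close>
  have "0 \<le> (3 * (1 + lam) - 1) * (lam - x)" using lam xyt by (intro mult_nonneg_nonneg) auto
  then have lx: "lam - x + 3 * ((1 + lam) * x) \<le> 3 * ((1 + lam) * lam)" by (simp add: algebra_simps)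
  show "cmod (taylor_coeff g 2) \<le> 1 + lam" unfolding A(1) by (rule Q1)
  have "cmod (taylor_coeff g 3) \<le> x + t\<^sup>2"
    unfolding A(2) x_def t_def norm_power[symmetric] by (rule norm_triangle_ineq)
  also have "\<dots> \<le> lam + (1 + lam)\<^sup>2" using xyt(2) t2 by linarith
  finally show "cmod (taylor_coeff g 3) \<le> 1 + 3 * lam + lam\<^sup>2"
    by (simp add: power2_eq_square algebra_simps)
  have "cmod (taylor_coeff g 4) \<le> cmod (fps_nth Q 3) + cmod (3 * fps_nth Q 1 * fps_nth Q 2) + cmod (fps_nth Q 1 ^ 3)"
    unfolding A(3) by (intro norm_triangle_mono norm_triangle_ineq order_refl)
  also have "\<dots> = y + 3 * (t * x) + t ^ 3"
    by (simp add: x_def y_def t_def norm_mult norm_power)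
  also have "\<dots> \<le> 3 * ((1 + lam) * lam) + (1 + lam) ^ 3" using y tx lx t3 by linarith
  also have "\<dots> = (1 + lam) * (1 + 5 * lam + lam\<^sup>2)"
    by (simp add: power2_eq_square power3_eq_cube algebra_simps)
  finally show "cmod (taylor_coeff g 4) \<le> (1 + lam) * (1 + 5 * lam + lam\<^sup>2)" .
qed

section \<open>Sharpness\<close>

text \<open>Taking the identity as Schwarz function gives
  \<open>f z = z / ((1 + z) * (1 + lam * z))\<close>. The coefficients \<open>1 + lam\<close>,
  \<open>lam\<close>, \<open>0\<close> of \<open>z / f\<close> are nonnegative, so one function
  attains all three bounds.\<close>

lemma extremal_function:
  fixes lam :: real
  assumes lam: "0 < lam" "lam \<le> 1"
  defines "G \<equiv> (\<lambda>z::complex. 1 / ((1 + z) * (1 + complex_of_real lam * z)))"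
  obtains f g where "f \<in> class_U lam" "quot_fz f \<prec>\<^sub>D G" "is_local_inverse f g"
    "taylor_coeff g 2 = of_real (1 + lam)"
    "taylor_coeff g 3 = of_real (1 + 3 * lam + lam\<^sup>2)"
    "taylor_coeff g 4 = of_real ((1 + lam) * (1 + 5 * lam + lam\<^sup>2))"
proof -
  define q :: "complex \<Rightarrow> complex" where "q z = (1 + z) * (1 + of_real lam * z)" for z
  define f where "f z = z / q z" for z
  have hq: "q holomorphic_on unit_disk" unfolding q_def by (intro holomorphic_intros)
  have nz: "q z \<noteq> 0" if "z \<in> unit_disk" for z
  proof -
    have z: "cmod z < 1" using that by simp
    have "cmod (of_real lam * z) \<le> 1 * cmod z"
      unfolding norm_mult using lam by (intro mult_right_mono) auto
    then have z': "cmod (of_real lam * z) < 1" using z by simp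
    have "1 + u \<noteq> 0" if "cmod u < 1" for u :: complex
      using that by (metis add_eq_0_iff norm_minus_cancel norm_one less_irrefl)
    then show ?thesis using z z' by (simp add: q_def)
  qed
  have q0: "q 0 = 1" by (simp add: q_def)
  have dq: "deriv q z = 1 + of_real lam + 2 * of_real lam * z" for z
    unfolding q_def by (rule DERIV_imp_deriv) (auto intro!: derivative_eq_intros simp: algebra_simps)
  \<comment> \<open>The deviation from \<open>1\<close> has modulus
    \<open>lam * (cmod z)\<^sup>2\<close>, below \<open>lam\<close> throughout the open
    disk.\<close>
  have fU: "(quot_zf f z)\<^sup>2 * deriv f z = 1 - of_real lam * z\<^sup>2" if "z \<in> unit_disk" for z
    using class_U_functional[OF hq that f_def nz q0]
    by (simp add: dq) (simp add: q_def power2_eq_square algebra_simps)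
  have A: "f \<in> class_A"
  proof -
    have "f holomorphic_on unit_disk" unfolding f_def by (intro holomorphic_intros hq nz) auto
    moreover have "deriv f 0 = 1" using fU[of 0] by (simp add: quot_zf_def)
    ultimately show ?thesis by (simp add: class_A_def f_def)
  qed
  have U: "f \<in> class_U lam"
  proof -
    have "lam * (cmod z)\<^sup>2 < lam" if "cmod z < 1" for z
      using that lam by (simp add: abs_square_less_1)
    then show ?thesis
      using A nz by (auto simp: class_U_def fU norm_mult norm_power lam(1) abs_of_pos)
        (auto simp: f_def)
  qed
  have G: "G = (\<lambda>z. 1 / q z)" by (simp add: G_def q_def)
  have hG: "G holomorphic_on unit_disk" unfolding G by (intro holomorphic_intros hq nz) auto
  have fG: "quot_fz f z = G z" for z by (simp add: quot_fz_def f_def G q0)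
  have S: "quot_fz f \<prec>\<^sub>D G"
    unfolding subordinate_def
  proof (intro conjI exI[of _ "\<lambda>z. z"])
    show "quot_fz f holomorphic_on unit_disk" using hG fG by (metis ext)
  qed (auto simp: fG hG)
  obtain g where g: "is_local_inverse f g" using local_inverse_exists[OF A] by blast
  define Q :: "complex fps" where "Q = (1 + fps_X) * (1 + fps_const (of_real lam) * fps_X)"
  have Q: "q has_fps_expansion Q"
    unfolding q_def Q_def by (intro fps_expansion_intros)
  have c: "fps_nth Q 0 = 1" "fps_nth Q 1 = 1 + of_real lam" "fps_nth Q 2 = of_real lam" "fps_nth Q 3 = 0"
    by (simp_all add: Q_def distrib_right)
  note C = local_inverse_coeffs[OF g Q c(1) f_def nz]
  show ?thesis
  proof (rule that[OF U S g])
    show "taylor_coeff g 2 = of_real (1 + lam)" using C(1) c by simp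
    show "taylor_coeff g 3 = of_real (1 + 3 * lam + lam\<^sup>2)"
      using C(2) c by (simp add: power2_eq_square algebra_simps)
    show "taylor_coeff g 4 = of_real ((1 + lam) * (1 + 5 * lam + lam\<^sup>2))"
      using C(3) c by (simp add: power2_eq_square power3_eq_cube algebra_simps)
  qed
qed

theorem theorem1:
  fixes lam :: real
  assumes lam: "0 < lam" "lam \<le> 1"
  defines "G \<equiv> (\<lambda>z::complex. 1 / ((1 + z) * (1 + complex_of_real lam * z)))"
  shows "(\<forall>f g. f \<in> class_U lam \<and> quot_fz f \<prec>\<^sub>D G \<and> is_local_inverse f g \<longrightarrow>
            cmod (taylor_coeff g 2) \<le> 1 + lam \<and>
            cmod (taylor_coeff g 3) \<le> 1 + 3 * lam + lam\<^sup>2 \<and>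
            cmod (taylor_coeff g 4) \<le> (1 + lam) * (1 + 5 * lam + lam\<^sup>2))
       \<and> (\<exists>f g. f \<in> class_U lam \<and> quot_fz f \<prec>\<^sub>D G \<and> is_local_inverse f g \<and>
            cmod (taylor_coeff g 2) = 1 + lam)
       \<and> (\<exists>f g. f \<in> class_U lam \<and> quot_fz f \<prec>\<^sub>D G \<and> is_local_inverse f g \<and>
            cmod (taylor_coeff g 3) = 1 + 3 * lam + lam\<^sup>2)
       \<and> (\<exists>f g. f \<in> class_U lam \<and> quot_fz f \<prec>\<^sub>D G \<and> is_local_inverse f g \<and>
            cmod (taylor_coeff g 4) = (1 + lam) * (1 + 5 * lam + lam\<^sup>2))"
proof -
  obtain f g where fg: "f \<in> class_U lam" "quot_fz f \<prec>\<^sub>D G" "is_local_inverse f g"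
    "taylor_coeff g 2 = of_real (1 + lam)"
    "taylor_coeff g 3 = of_real (1 + 3 * lam + lam\<^sup>2)"
    "taylor_coeff g 4 = of_real ((1 + lam) * (1 + 5 * lam + lam\<^sup>2))"
    unfolding G_def by (rule extremal_function[OF lam])
  have "cmod (taylor_coeff g 2) = 1 + lam"
    "cmod (taylor_coeff g 3) = 1 + 3 * lam + lam\<^sup>2"
    "cmod (taylor_coeff g 4) = (1 + lam) * (1 + 5 * lam + lam\<^sup>2)"
    unfolding fg norm_of_real using lam by (auto intro!: abs_of_nonneg)
  then show ?thesis
    using U_subordinate_bounds[OF lam(1)] fg(1-3) unfolding G_def by blast
qed

end
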